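(* Let $q\in(0,1)$ and $0<a<b$. Let $f:[a,b]\to\mathbb{R}$ be a continuous convex function. Then $$f\left(\frac{aq+b}{[2]_q}\right)\le\frac{1}{b-a}R_q(f;a,b)\le\frac{1}{[2]_q}\bigl(q\,f(a)+f(b)\bigr).$$
   Context: For $q\in(0,1)$ and $0<a<b$, the Riemann-type $q$-integral is $R_q(f;a,b)=(b-a)(1-q)\sum_{k=0}^{\infty}f\bigl(a+(b-a)q^k\bigr)q^k$. Also $[2]_q=1+q$. *)

theory Defs
  imports "HOL-Analysis.Analysis"
begin

definition Rq :: "real \<Rightarrow> (real \<Rightarrow> real) \<Rightarrow> real \<Rightarrow> real \<Rightarrow> real" where
  "Rq q f a b = (b - a) * (1 - q) * (\<Sum>k. f (a + (b - a) * q ^ k) * q ^ k)"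

definition q_two :: "real \<Rightarrow> real" ("[2]\<^bsub>_\<^esub>") where
  "[2]\<^bsub>q\<^esub> = 1 + q"

text \<open>The series defining \<^const>\<open>Rq\<close> converges for every function that is continuous
  on the interval, so \<^const>\<open>suminf\<close> is its genuine value there.\<close>

lemma summable_Rq:
  fixes f :: "real \<Rightarrow> real" and q a b :: real
  assumes q: "0 < q" "q < 1" and ab: "a < b" and cont: "continuous_on {a..b} f"
  shows "summable (\<lambda>k. f (a + (b - a) * q ^ k) * q ^ k)"
proof -
  have "bounded (f ` {a..b})"
    using cont by (intro compact_imp_bounded compact_continuous_image) auto
  then obtain M where M: "\<And>x. x \<in> {a..b} \<Longrightarrow> \<bar>f x\<bar> \<le> M"
    unfolding bounded_iff by fastforce
  have mem: "a + (b - a) * q ^ k \<in> {a..b}" for k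
  proof -
    have "0 \<le> q ^ k" "q ^ k \<le> 1" using q by (auto intro: power_le_one)
    then have "(b - a) * q ^ k \<le> (b - a) * 1" "0 \<le> (b - a) * q ^ k"
      using ab by (auto intro!: mult_left_mono mult_nonneg_nonneg simp del: mult_1_right)
    then show ?thesis by auto
  qed
  show ?thesis
  proof (rule summable_comparison_test')
    show "summable (\<lambda>k. M * q ^ k)" using q by (intro summable_mult summable_geometric) auto
    show "norm (f (a + (b - a) * q ^ k) * q ^ k) \<le> M * q ^ k" for k
      using M[OF mem[of k]] q by (simp add: abs_mult mult_right_mono)
  qed
qed

end

theory Submission
  imports Defs
begin

text \<open>
  Dividing \<^const>\<open>Rq\<close> by \<open>b - a\<close> gives the mean of \<open>f\<close> at the points \<open>a + (b - a) * q ^ k\<close>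
  with the weights \<open>(1 - q) * q ^ k\<close>, which sum to \<open>1\<close>. This mean is monotone in \<open>f\<close>
  (\<open>weighted_suminf_le\<close>), and the weighted mean of \<open>q ^ k\<close> is \<open>1 / (1 + q)\<close>, so it can be
  evaluated on affine functions (\<open>affine_q_mean_sums\<close>); the barycentre of the points is
  \<open>m = (a * q + b) / (1 + q)\<close>. A convex \<open>f\<close> lies above a supporting line at the interior
  point \<open>m\<close>, whose mean is \<open>f m\<close>, and below its chord, whose mean is
  \<open>(q * f a + f b) / (1 + q)\<close>.
\<close>

lemma affine_q_mean_sums:
  fixes q c d :: real
  assumes "0 < q" "q < 1"
  shows "(\<lambda>k. (1 - q) * ((c + d * q ^ k) * q ^ k)) sums (c + d / (1 + q))"
proof -
  have "(\<lambda>k. q ^ k) sums (1 / (1 - q))"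
    using assms by (intro geometric_sums) auto
  moreover have "(\<lambda>k. (q\<^sup>2) ^ k) sums (1 / (1 - q\<^sup>2))"
    using assms by (intro geometric_sums) (simp add: power_less_one_iff)
  ultimately have "(\<lambda>k. (1 - q) * (c * q ^ k + d * (q\<^sup>2) ^ k)) sums
      ((1 - q) * (c * (1 / (1 - q)) + d * (1 / (1 - q\<^sup>2))))"
    by (intro sums_mult sums_add)
  moreover have "(1 - q) * (c * q ^ k + d * (q\<^sup>2) ^ k) = (1 - q) * ((c + d * q ^ k) * q ^ k)" for k
    by (simp add: algebra_simps power2_eq_square power_mult_distrib)
  moreover have "(1 - q) * (c * (1 / (1 - q)) + d * (1 / (1 - q\<^sup>2))) = c + d / (1 + q)"
  proof -
    have "1 - q\<^sup>2 = (1 - q) * (1 + q)"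
      by (simp add: algebra_simps power2_eq_square)
    then have "(1 - q) * (1 / (1 - q\<^sup>2)) = 1 / (1 + q)"
      using assms by (simp only:) simp
    moreover have "(1 - q) * (1 / (1 - q)) = 1"
      using assms by simp
    ultimately show ?thesis
      by (simp only: distrib_left mult.left_commute[of "1 - q"]) simp
  qed
  ultimately show ?thesis by simp
qed

lemma weighted_suminf_le:
  fixes g h :: "nat \<Rightarrow> real" and q :: real
  assumes "0 < q" "q < 1"
    and "summable (\<lambda>k. g k * q ^ k)" "summable (\<lambda>k. h k * q ^ k)"
    and "\<And>k. g k \<le> h k"
  shows "(1 - q) * (\<Sum>k. g k * q ^ k) \<le> (1 - q) * (\<Sum>k. h k * q ^ k)"
  using assms by (intro mult_left_mono suminf_le mult_right_mono) auto

theorem theorem5p3: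
  fixes f :: "real \<Rightarrow> real" and q a b :: real
  assumes "0 < q" "q < 1"
    and "0 < a" "a < b"
    and "continuous_on {a..b} f"
    and "convex_on {a..b} f"
  shows "f ((a * q + b) / [2]\<^bsub>q\<^esub>) \<le> 1 / (b - a) * Rq q f a b
       \<and> 1 / (b - a) * Rq q f a b \<le> 1 / [2]\<^bsub>q\<^esub> * (q * f a + f b)"
proof
  define x where "x k = a + (b - a) * q ^ k" for k
  define m where "m = (a * q + b) / (1 + q)"
  have mean: "1 / (b - a) * Rq q f a b = (1 - q) * (\<Sum>k. f (x k) * q ^ k)"
    using assms(4) by (simp add: Rq_def x_def)
  have summable_f: "summable (\<lambda>k. f (x k) * q ^ k)"
    unfolding x_def using assms by (intro summable_Rq)
  have summable_affine: "summable (\<lambda>k. (c + d * q ^ k) * q ^ k)"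
    and mean_affine: "(1 - q) * (\<Sum>k. (c + d * q ^ k) * q ^ k) = c + d / (1 + q)" for c d
  proof -
    have sums: "(\<lambda>k. (1 - q) * ((c + d * q ^ k) * q ^ k)) sums (c + d / (1 + q))"
      using affine_q_mean_sums assms(1,2) .
    then show summable: "summable (\<lambda>k. (c + d * q ^ k) * q ^ k)"
      using assms(2) summable_mult_D[OF sums_summable[OF sums]] by simp
    show "(1 - q) * (\<Sum>k. (c + d * q ^ k) * q ^ k) = c + d / (1 + q)"
      using sums_unique[OF sums] suminf_mult[OF summable, of "1 - q"] by simp
  qed
  have pow: "0 \<le> q ^ k" "q ^ k \<le> 1" for k
    using assms(1,2) by (auto intro: power_le_one)
  have x_convex: "x k = (1 - q ^ k) * a + q ^ k * b" for k
    by (simp add: x_def algebra_simps)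
  have x_mem: "x k \<in> {a..b}" for k
  proof -
    have "0 \<le> (b - a) * q ^ k" "(b - a) * q ^ k \<le> b - a"
      using pow[of k] assms(4) by (simp_all add: mult_left_le)
    then show ?thesis by (simp add: x_def)
  qed

  have "a < m" "m < b"
    using assms by (simp_all add: m_def field_simps)
  then have "m \<in> interior {a..b}" by simp
  then obtain s where support: "\<And>y. y \<in> {a..b} \<Longrightarrow> f m + s * (y - m) \<le> f y"
    using convex_le_Inf_differential[OF assms(6)] by blast
  have "f m + s * (a - m) + s * (b - a) * q ^ k \<le> f (x k)" for k
    using support[OF x_mem[of k]] by (simp add: x_def algebra_simps)
  then have "f m + s * (a - m) + s * (b - a) / (1 + q) \<le> (1 - q) * (\<Sum>k. f (x k) * q ^ k)"
    using weighted_suminf_le[OF assms(1,2) summable_affine summable_f] mean_affine by metis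
  moreover have "f m + s * (a - m) + s * (b - a) / (1 + q) = f m"
  proof -
    have "m = a + (b - a) / (1 + q)"
      using assms(1) by (simp add: m_def field_simps)
    then show ?thesis by (simp add: algebra_simps)
  qed
  ultimately have "f m \<le> (1 - q) * (\<Sum>k. f (x k) * q ^ k)"
    by simp
  then show "f ((a * q + b) / [2]\<^bsub>q\<^esub>) \<le> 1 / (b - a) * Rq q f a b"
    by (simp only: mean q_two_def m_def)

  have "f (x k) \<le> f a + (f b - f a) * q ^ k" for k
    using convex_onD[OF assms(6) pow, of a b k] assms(4)
    by (simp add: x_convex algebra_simps)
  then have "(1 - q) * (\<Sum>k. f (x k) * q ^ k) \<le> f a + (f b - f a) / (1 + q)"
    using weighted_suminf_le[OF assms(1,2) summable_f summable_affine] mean_affine by metis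
  also have "\<dots> = 1 / (1 + q) * (q * f a + f b)"
    using assms(1) by (simp add: field_simps)
  finally show "1 / (b - a) * Rq q f a b \<le> 1 / [2]\<^bsub>q\<^esub> * (q * f a + f b)"
    by (simp only: mean q_two_def)
qed

end
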